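(* The strong price of stability of financial network games under priority-proportional strategies is $1$, even with default costs $\alpha,\beta\in[0,1]$ and negative external assets, when firms aim to maximize their equity. That is, in every such game (debt contracts only) there is a strong equilibrium $\mathbf{s}$ with $SW(\mathbf{P}(\mathbf{s}))=OPT$.
   Context: Financial network: firms $v_1,\dots,v_n$; each $v_i$ has external assets $e_i\in\mathbb{R}$, possibly negative (a negative value represents an obligation to entities outside the network, which absorbs available funds first); $v_i$ owes $v_j$ the liability $l_{ij}\ge 0$, with $l_{ii}=0$ (both $l_{ij}>0$ and $l_{ji}>0$ are allowed); $L_i=\sum_j l_{ij}$. Default costs $\alpha,\beta\in[0,1]$: a firm in default can use only an $\alpha$ fraction of its external assets (when these are positive) and a $\beta$ fraction of its incoming payments. Priority-proportional strategy: a strategy $s_i$ of $v_i$ is a complete ordering, allowing ties, of its creditors, i.e. an ordered partition of $\{v_j: l_{ij}>0\}$ into priority classes $1,2,\dots$. Write $L_i^{(m)}$ for the total liability of $v_i$ to its $m$-th class, $k_{ij}$ for the index of the class of $v_i$ containing $v_j$, and $\pi'_{ij}=l_{ij}/L_i^{(k_{ij})}$. Clearing payments consistent with a strategy profile $\mathbf{s}=(s_1,\dots,s_n)$: a matrix $\mathbf{P}=(p_{ij})$ with $p_{ii}=0$, $0\le p_{ij}\le l_{ij}$ and, writing $p_i=\sum_j p_{ij}$, for every $i$: $p_i=L_i$ if $L_i\le e_i+\sum_j p_{ji}$ (solvent), and $p_i=\max\{0,\ \alpha\max\{e_i,0\}+\min\{e_i,0\}+\beta\sum_j p_{ji}\}$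 otherwise (in default); moreover for every creditor $v_j$ of $v_i$, $$p_{ij}=\min\Big\{\max\Big\{\Big(p_i-\sum_{m=1}^{k_{ij}-1}L_i^{(m)}\Big)\pi'_{ij},\,0\Big\},\,l_{ij}\Big\},$$ and $p_{ij}=0$ if $l_{ij}=0$. Clearing payments are proper if every firm with a positive outgoing payment is reachable, by a (possibly trivial) directed path of edges $(v_i,v_j)$ with $p_{ij}>0$, from some firm with positive external assets. Only proper clearing payments are considered. For every profile $\mathbf{s}$ there are maximal ones, denoted $\mathbf{P}(\mathbf{s})$, which are entrywise at least as large as all other proper clearing payments consistent with $\mathbf{s}$. Equity: $E_i(\mathbf{P})=\max\{0,\ e_i+\sum_j p_{ji}-L_i\}$. The utility of $v_i$ under $\mathbf{s}$ is $E_i(\mathbf{P}(\mathbf{s}))$. A profile is a strong equilibrium if no non-empty coalition of firms can jointly change their strategies (the other firms' strategies being fixed) so that every member of the coalition obtains strictly greater utility. Social welfare: $SW(\mathbf{P})=\sum_i E_i(\mathbf{P})$; $OPT$ is the maximum of $SW(\mathbf{P}(\mathbf{s}))$ over all strategy profiles. The strong price of stability of an instance is the minimum of $OPT/SW(\mathbf{P}(\mathbf{s}))$ over strong equilibria $\mathbf{s}$ (with $0/0=1$); that of a class of games is the supremum over its instances. *)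

theory Defs
  imports Complex_Main "HOL-Library.FuncSet" "HOL-Library.Extended_Real"
begin

text \<open>
  The firms are \<open>0, \<dots>, firm_count G - 1\<close>; the values of \<open>assets\<close> and \<open>liability\<close>
  at other indices play no role anywhere below.
\<close>

record financial_network =
  firm_count :: nat
  assets :: "nat \<Rightarrow> real"
  liability :: "nat \<Rightarrow> nat \<Rightarrow> real"
  alpha :: real
  beta :: real

definition firms :: "financial_network \<Rightarrow> nat set" where
  "firms G = {..<firm_count G}"

definition valid_network :: "financial_network \<Rightarrow> bool" where
  "valid_network G \<longleftrightarrow>
     (\<forall>i\<in>firms G. \<forall>j\<in>firms G. 0 \<le> liability G i j) \<and>
     (\<forall>i\<in>firms G. liability G i i = 0) \<and>
     0 \<le> alpha G \<and> alpha G \<le> 1 \<and> 0 \<le> beta G \<and> beta G \<le> 1"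

definition total_liability :: "financial_network \<Rightarrow> nat \<Rightarrow> real" where
  "total_liability G i = (\<Sum>j\<in>firms G. liability G i j)"

definition creditors :: "financial_network \<Rightarrow> nat \<Rightarrow> nat set" where
  "creditors G i = {j \<in> firms G. 0 < liability G i j}"

text \<open>
  A strategy is an ordered partition of the creditors, represented as the list of its
  priority classes, highest priority first. List positions count from 0, so position
  \<open>k\<close> holds priority class \<open>k + 1\<close>. Profiles are extensional (\<open>undefined\<close> outside the
  set of firms), so they correspond exactly to tuples of strategies.
\<close>

definition strategies :: "financial_network \<Rightarrow> nat \<Rightarrow> nat set list set" where
  "strategies G i =
     {cs. {} \<notin> set cs \<and> \<Union> (set cs) = creditors G i \<and>
          (\<forall>k<length cs. \<forall>m<length cs. k \<noteq> m \<longrightarrow> cs ! k \<inter> cs ! m = {})}"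

definition profiles :: "financial_network \<Rightarrow> (nat \<Rightarrow> nat set list) set" where
  "profiles G = (\<Pi>\<^sub>E i\<in>firms G. strategies G i)"

definition class_liability ::
    "financial_network \<Rightarrow> (nat \<Rightarrow> nat set list) \<Rightarrow> nat \<Rightarrow> nat \<Rightarrow> real" where
  "class_liability G s i m = (\<Sum>j\<in>s i ! m. liability G i j)"

definition outgoing :: "financial_network \<Rightarrow> (nat \<Rightarrow> nat \<Rightarrow> real) \<Rightarrow> nat \<Rightarrow> real" where
  "outgoing G P i = (\<Sum>j\<in>firms G. P i j)"

definition incoming :: "financial_network \<Rightarrow> (nat \<Rightarrow> nat \<Rightarrow> real) \<Rightarrow> nat \<Rightarrow> real" where
  "incoming G P i = (\<Sum>j\<in>firms G. P j i)"

text \<open>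
  The first conjunct of the next definition only fixes the entries that do not belong to
  the payment matrix, so that two payment functions are equal iff their matrices are.
  In the last conjunct \<open>k\<close> is the position of the class of firm \<open>i\<close> containing \<open>j\<close>; every
  creditor of \<open>i\<close> lies in exactly one class.
\<close>

definition clearing_payments ::
    "financial_network \<Rightarrow> (nat \<Rightarrow> nat set list) \<Rightarrow> (nat \<Rightarrow> nat \<Rightarrow> real) \<Rightarrow> bool" where
  "clearing_payments G s P \<longleftrightarrow>
     (\<forall>i j. i \<notin> firms G \<or> j \<notin> firms G \<longrightarrow> P i j = 0) \<and>
     (\<forall>i\<in>firms G. P i i = 0) \<and>
     (\<forall>i\<in>firms G. \<forall>j\<in>firms G. 0 \<le> P i j \<and> P i j \<le> liability G i j) \<and>
     (\<forall>i\<in>firms G. outgoing G P i =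
        (if total_liability G i \<le> assets G i + incoming G P i then total_liability G i
         else max 0 (alpha G * max (assets G i) 0 + min (assets G i) 0
                     + beta G * incoming G P i))) \<and>
     (\<forall>i\<in>firms G. \<forall>j\<in>firms G. liability G i j = 0 \<longrightarrow> P i j = 0) \<and>
     (\<forall>i\<in>firms G. \<forall>k<length (s i). \<forall>j\<in>s i ! k.
        P i j = min (max ((outgoing G P i - (\<Sum>m<k. class_liability G s i m))
                          * (liability G i j / class_liability G s i k)) 0)
                    (liability G i j))"

definition payment_edges ::
    "financial_network \<Rightarrow> (nat \<Rightarrow> nat \<Rightarrow> real) \<Rightarrow> (nat \<times> nat) set" where
  "payment_edges G P = {(i, j). i \<in> firms G \<and> j \<in> firms G \<and> 0 < P i j}"

definition proper_payments :: "financial_network \<Rightarrow> (nat \<Rightarrow> nat \<Rightarrow> real) \<Rightarrow> bool" where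
  "proper_payments G P \<longleftrightarrow>
     (\<forall>i\<in>firms G. 0 < outgoing G P i \<longrightarrow>
        (\<exists>k\<in>firms G. 0 < assets G k \<and> (k, i) \<in> (payment_edges G P)\<^sup>*))"

definition maximal_clearing_payments ::
    "financial_network \<Rightarrow> (nat \<Rightarrow> nat set list) \<Rightarrow> (nat \<Rightarrow> nat \<Rightarrow> real) \<Rightarrow> bool" where
  "maximal_clearing_payments G s P \<longleftrightarrow>
     clearing_payments G s P \<and> proper_payments G P \<and>
     (\<forall>Q. clearing_payments G s Q \<and> proper_payments G Q \<longrightarrow>
        (\<forall>i\<in>firms G. \<forall>j\<in>firms G. Q i j \<le> P i j))"

definition payments ::
    "financial_network \<Rightarrow> (nat \<Rightarrow> nat set list) \<Rightarrow> nat \<Rightarrow> nat \<Rightarrow> real" where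
  "payments G s = (THE P. maximal_clearing_payments G s P)"

definition equity :: "financial_network \<Rightarrow> (nat \<Rightarrow> nat \<Rightarrow> real) \<Rightarrow> nat \<Rightarrow> real" where
  "equity G P i = max 0 (assets G i + incoming G P i - total_liability G i)"

definition utility :: "financial_network \<Rightarrow> (nat \<Rightarrow> nat set list) \<Rightarrow> nat \<Rightarrow> real" where
  "utility G s i = equity G (payments G s) i"

definition strong_equilibrium :: "financial_network \<Rightarrow> (nat \<Rightarrow> nat set list) \<Rightarrow> bool" where
  "strong_equilibrium G s \<longleftrightarrow>
     s \<in> profiles G \<and>
     \<not> (\<exists>C s'. C \<noteq> {} \<and> C \<subseteq> firms G \<and> s' \<in> profiles G \<and>
               (\<forall>i\<in>firms G - C. s' i = s i) \<and>
               (\<forall>i\<in>C. utility G s i < utility G s' i))"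

definition social_welfare :: "financial_network \<Rightarrow> (nat \<Rightarrow> nat \<Rightarrow> real) \<Rightarrow> real" where
  "social_welfare G P = (\<Sum>i\<in>firms G. equity G P i)"

text \<open>The set of profiles is finite and nonempty, so this is a genuine maximum.\<close>

definition optimal_welfare :: "financial_network \<Rightarrow> real" where
  "optimal_welfare G = Max ((\<lambda>s. social_welfare G (payments G s)) ` profiles G)"

definition welfare_ratio :: "real \<Rightarrow> real \<Rightarrow> ereal" where
  "welfare_ratio opt sw =
     (if sw = 0 then (if opt = 0 then 1 else \<infinity>) else ereal (opt / sw))"

text \<open>
  For a game with a strong equilibrium the infimum is over a finite nonempty set of ratios
  and hence a minimum; for a game without one it is \<open>\<infinity>\<close>.
\<close>

definition strong_price_of_stability :: "financial_network \<Rightarrow> ereal" where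
  "strong_price_of_stability G =
     (INF s\<in>{s. strong_equilibrium G s}.
        welfare_ratio (optimal_welfare G) (social_welfare G (payments G s)))"

definition class_strong_price_of_stability :: "financial_network set \<Rightarrow> ereal" where
  "class_strong_price_of_stability \<G> = (SUP G\<in>\<G>. strong_price_of_stability G)"

end

theory Submission
  imports Defs
begin

text \<open>
  Every profile is a strong equilibrium. If a coalition deviates from \<open>s\<close> to \<open>s'\<close> and all its
  members gain, then they all have positive equity under \<open>s'\<close>, so they are solvent and pay their
  debts in full, whatever priorities they use. Hence the clearing payments of \<open>s'\<close> are also
  consistent with \<open>s\<close>, and by maximality they are dominated by those of \<open>s\<close>; so no member gained.

  It remains to see that maximal proper clearing payments exist. The greatest clearing payments
  come from the Knaster--Tarski argument applied to the vector of outgoing payments. Firms that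
  are unreachable from positive external assets receive payments only from each other and own
  nothing else, so by conservation they pay nothing to reachable firms; erasing their payments
  therefore leaves clearing payments, and these are proper.
\<close>

section \<open>Greatest fixed points and capped sums\<close>

text \<open>The pointwise supremum of all \<open>q\<close> in the box with
  \<open>q \<le> F q\<close> is the fixed point. The codomain is only conditionally complete: the
  member \<open>lo\<close> and the bound \<open>hi\<close> make these suprema meaningful.\<close>

lemma greatest_fixed_point_in_box:
  fixes F :: "('a \<Rightarrow> 'b::conditionally_complete_lattice) \<Rightarrow> 'a \<Rightarrow> 'b"
  assumes "lo \<le> hi"
    and F_box: "\<And>p. lo \<le> p \<Longrightarrow> p \<le> hi \<Longrightarrow> lo \<le> F p \<and> F p \<le> hi"
    and F_mono: "\<And>p q. lo \<le> p \<Longrightarrow> p \<le> q \<Longrightarrow> q \<le> hi \<Longrightarrow> F p \<le> F q"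
  obtains p where "lo \<le> p" "p \<le> hi" "F p = p"
    "\<And>q. lo \<le> q \<Longrightarrow> q \<le> hi \<Longrightarrow> F q = q \<Longrightarrow> q \<le> p"
proof -
  define D where "D = {q. lo \<le> q \<and> q \<le> hi \<and> q \<le> F q}"
  define p where "p = (\<lambda>a. SUP q\<in>D. q a)"
  have lo_D: "lo \<in> D"
    using assms(1) F_box unfolding D_def by blast
  have bdd: "bdd_above ((\<lambda>q. q a) ` D)" for a
    by (rule bdd_aboveI[of _ "hi a"]) (auto simp: D_def le_fun_def)
  have upper: "q \<le> p" if "q \<in> D" for q
    using that bdd by (auto simp: p_def le_fun_def intro: cSUP_upper)
  have least: "p \<le> r" if "\<And>q. q \<in> D \<Longrightarrow> q \<le> r" for r
    using that lo_D unfolding p_def le_fun_def by (intro allI cSUP_least) auto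
  have "lo \<le> p"
    using upper lo_D .
  have "p \<le> hi"
    by (rule least) (simp add: D_def)
  have "p \<le> F p"
  proof (rule least)
    fix q assume q: "q \<in> D"
    then have "q \<le> F q" "F q \<le> F p"
      using F_mono[OF _ upper \<open>p \<le> hi\<close>] by (auto simp: D_def)
    then show "q \<le> F p" by (rule order_trans)
  qed
  moreover have "F p \<le> p"
  proof (rule upper)
    show "F p \<in> D"
      using F_box[OF \<open>lo \<le> p\<close> \<open>p \<le> hi\<close>] F_mono[OF \<open>lo \<le> p\<close> \<open>p \<le> F p\<close>]
      by (auto simp: D_def)
  qed
  ultimately have "F p = p" by (rule antisym[rotated])
  show thesis
  proof (rule that[OF \<open>lo \<le> p\<close> \<open>p \<le> hi\<close> \<open>F p = p\<close>])
    fix q assume "lo \<le> q" "q \<le> hi" "F q = q"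
    then show "q \<le> p" by (intro upper) (simp add: D_def)
  qed
qed

text \<open>Pouring \<open>x\<close> into containers of capacities \<open>c k\<close> in order: the
  \<open>k\<close>-th term is the increment of \<open>min x\<close> of the partial sums of
  \<open>c\<close>, so the sum telescopes.\<close>

lemma sum_successive_caps:
  fixes x :: real and n :: nat
  assumes "0 \<le> x" "\<forall>k<n. 0 \<le> c k"
  shows "(\<Sum>k<n. min (max (x - (\<Sum>m<k. c m)) 0) (c k)) = min x (\<Sum>k<n. c k)"
  using assms(2)
proof (induction n)
  case 0
  then show ?case using assms(1) by simp
next
  case (Suc n)
  have "(\<Sum>k<n. min (max (x - (\<Sum>m<k. c m)) 0) (c k)) = min x (\<Sum>k<n. c k)"
    using Suc by simp
  moreover have "0 \<le> c n" using Suc.prems by simp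
  ultimately show ?case by (simp add: min_def max_def)
qed

lemma finite_firms [simp]: "finite (firms G)"
  by (simp add: firms_def)

section \<open>Splitting a payment among the priority classes\<close>

text \<open>The payment rule as a function of the payer's total payment \<open>x\<close>. The class
  index is encoded by a sum with an indicator, which involves no choice of a class, gives 0 to
  non-creditors and lets sums over firms and classes be exchanged.\<close>

definition share ::
    "financial_network \<Rightarrow> (nat \<Rightarrow> nat set list) \<Rightarrow> nat \<Rightarrow> nat \<Rightarrow> real \<Rightarrow> real" where
  "share G s i j x = (\<Sum>k<length (s i). if j \<in> s i ! k
     then min (max ((x - (\<Sum>m<k. class_liability G s i m))
                    * (liability G i j / class_liability G s i k)) 0) (liability G i j)
     else 0)"

text \<open>The amount paid out as a function of the inflow \<open>y\<close> alone, so that clearing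
  becomes a fixed-point condition.\<close>

definition total_payment :: "financial_network \<Rightarrow> nat \<Rightarrow> real \<Rightarrow> real" where
  "total_payment G i y =
     (if total_liability G i \<le> assets G i + y then total_liability G i
      else max 0 (alpha G * max (assets G i) 0 + min (assets G i) 0 + beta G * y))"

context
  fixes G :: financial_network
  assumes valid: "valid_network G"
begin

lemma liability_nonneg: "i \<in> firms G \<Longrightarrow> j \<in> firms G \<Longrightarrow> 0 \<le> liability G i j"
  and liability_self: "i \<in> firms G \<Longrightarrow> liability G i i = 0"
  and alpha_beta: "0 \<le> alpha G" "alpha G \<le> 1" "0 \<le> beta G" "beta G \<le> 1"
  using valid by (auto simp: valid_network_def)

lemma total_liability_nonneg: "i \<in> firms G \<Longrightarrow> 0 \<le> total_liability G i"
  unfolding total_liability_def by (intro sum_nonneg liability_nonneg)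

text \<open>Default costs only destroy money: both coefficients are at most 1, and the positive and
  negative parts of the assets add up to the assets.\<close>

lemma default_payment_le:
  assumes "0 \<le> y"
  shows "alpha G * max (assets G i) 0 + min (assets G i) 0 + beta G * y \<le> assets G i + y"
proof -
  have "alpha G * max (assets G i) 0 \<le> max (assets G i) 0"
    using alpha_beta by (intro mult_left_le_one_le) auto
  moreover have "beta G * y \<le> y"
    using alpha_beta assms by (intro mult_left_le_one_le) auto
  ultimately show ?thesis by linarith
qed

lemma total_payment_le_funds: "0 \<le> y \<Longrightarrow> total_payment G i y \<le> max 0 (assets G i + y)"
  using default_payment_le[of y i] unfolding total_payment_def by auto

lemma total_payment_bounds:
  assumes "i \<in> firms G" "0 \<le> y"
  shows "0 \<le> total_payment G i y" "total_payment G i y \<le> total_liability G i"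
  using default_payment_le[OF assms(2), of i] total_liability_nonneg[OF assms(1)]
  unfolding total_payment_def by auto

text \<open>The only discontinuity, where the firm becomes solvent, is a jump upwards to the full
  liability, which bounds every payment. Below it the default formula is monotone because
  \<open>beta G\<close> is nonnegative.\<close>

lemma total_payment_mono:
  assumes "i \<in> firms G" "0 \<le> y" "y \<le> z"
  shows "total_payment G i y \<le> total_payment G i z"
proof (cases "total_liability G i \<le> assets G i + z")
  case True
  then show ?thesis
    using total_payment_bounds[OF assms(1,2)] by (simp add: total_payment_def)
next
  case False
  moreover have "beta G * y \<le> beta G * z"
    using alpha_beta assms by (intro mult_left_mono) auto
  ultimately show ?thesis
    using assms by (auto simp: total_payment_def)
qed

context
  fixes s i
  assumes profile: "s \<in> profiles G" and firm: "i \<in> firms G"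
begin

lemma strategy: "s i \<in> strategies G i"
  using profile firm by (auto simp: profiles_def)

lemma class_subset:
  assumes "k < length (s i)"
  shows "s i ! k \<subseteq> creditors G i"
  using strategy nth_mem[OF assms] unfolding strategies_def by blast

lemma finite_class: "k < length (s i) \<Longrightarrow> finite (s i ! k)"
  by (rule finite_subset[OF class_subset]) (auto simp: creditors_def)

lemma class_liability_pos:
  assumes "k < length (s i)"
  shows "0 < class_liability G s i k"
proof -
  have "s i ! k \<noteq> {}"
    using strategy nth_mem[OF assms] by (auto simp: strategies_def)
  then show ?thesis
    unfolding class_liability_def using class_subset[OF assms] finite_class[OF assms]
    by (intro sum_pos) (auto simp: creditors_def)
qed

lemma class_unique:
  "k < length (s i) \<Longrightarrow> m < length (s i) \<Longrightarrow> j \<in> s i ! k \<Longrightarrow> j \<in> s i ! m \<Longrightarrow> m = k"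
  using strategy unfolding strategies_def by blast

lemma share_in_class:
  assumes "k < length (s i)" "j \<in> s i ! k"
  shows "share G s i j x =
    min (max ((x - (\<Sum>m<k. class_liability G s i m))
              * (liability G i j / class_liability G s i k)) 0) (liability G i j)"
    (is "_ = ?r k")
proof -
  have "share G s i j x = (\<Sum>m<length (s i). if m = k then ?r m else 0)"
    unfolding share_def using class_unique assms by (intro sum.cong) auto
  also have "\<dots> = ?r k"
    using assms by (subst sum.delta) auto
  finally show ?thesis .
qed

lemma ex_class:
  assumes "j \<in> creditors G i"
  shows "\<exists>k<length (s i). j \<in> s i ! k"
proof -
  have "j \<in> \<Union> (set (s i))"
    using strategy assms by (simp add: strategies_def)
  then show ?thesis by (metis UnionE in_set_conv_nth)
qed

lemma share_not_creditor:
  "j \<notin> creditors G i \<Longrightarrow> share G s i j x = 0"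
  unfolding share_def using class_subset by (intro sum.neutral) auto

lemma share_bounds:
  assumes "j \<in> firms G"
  shows "0 \<le> share G s i j x" "share G s i j x \<le> liability G i j"
proof -
  have "0 \<le> share G s i j x \<and> share G s i j x \<le> liability G i j"
  proof (cases "j \<in> creditors G i")
    case True
    then obtain k where "k < length (s i)" "j \<in> s i ! k" using ex_class by blast
    then show ?thesis
      using liability_nonneg[OF firm assms] by (simp add: share_in_class)
  qed (simp add: share_not_creditor liability_nonneg[OF firm assms])
  then show "0 \<le> share G s i j x" "share G s i j x \<le> liability G i j" by simp_all
qed

lemma share_mono:
  assumes "j \<in> firms G" "x \<le> y"
  shows "share G s i j x \<le> share G s i j y"
proof (cases "j \<in> creditors G i")
  case True
  then obtain k where k: "k < length (s i)" "j \<in> s i ! k" using ex_class by blast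
  have "(x - c) * (liability G i j / class_liability G s i k)
      \<le> (y - c) * (liability G i j / class_liability G s i k)" for c
    using assms class_liability_pos[OF k(1)] liability_nonneg[OF firm assms(1)]
    by (intro mult_right_mono) auto
  then show ?thesis
    unfolding share_in_class[OF k] by (intro min.mono max.mono) auto
qed (simp add: share_not_creditor)

text \<open>Each member receives the fraction \<open>liability / class_liability\<close> of the
  amount \<open>min (max z 0) (class_liability G s i k)\<close>, and these fractions add up to
  1.\<close>

lemma sum_class_share:
  assumes "k < length (s i)"
  shows "(\<Sum>j\<in>s i ! k. min (max (z * (liability G i j / class_liability G s i k)) 0)
                            (liability G i j))
       = min (max z 0) (class_liability G s i k)"
proof -
  let ?L = "class_liability G s i k"
  have L: "0 < ?L" using class_liability_pos assms .
  have "min (max (z * (liability G i j / ?L)) 0) (liability G i j)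
      = min (max z 0) ?L / ?L * liability G i j" if "j \<in> s i ! k" for j
  proof -
    have l: "0 < liability G i j"
      using class_subset[OF assms] that by (auto simp: creditors_def)
    have "max (z * (liability G i j / ?L)) 0 = max z 0 * (liability G i j / ?L)"
      using L l by (subst max_mult_distrib_right) simp
    moreover have "liability G i j = ?L * (liability G i j / ?L)"
      using L by simp
    ultimately have "min (max (z * (liability G i j / ?L)) 0) (liability G i j)
        = min (max z 0 * (liability G i j / ?L)) (?L * (liability G i j / ?L))"
      by simp
    also have "\<dots> = min (max z 0) ?L * (liability G i j / ?L)"
      using L l by (subst min_mult_distrib_right) auto
    finally show ?thesis by simp
  qed
  then have "(\<Sum>j\<in>s i ! k. min (max (z * (liability G i j / ?L)) 0) (liability G i j))
      = (\<Sum>j\<in>s i ! k. min (max z 0) ?L / ?L * liability G i j)"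
    by (rule sum.cong[OF refl])
  also have "\<dots> = min (max z 0) ?L / ?L * ?L"
    by (simp add: class_liability_def sum_distrib_left)
  finally show ?thesis using L by simp
qed

lemma sum_over_classes:
  "(\<Sum>j\<in>firms G. \<Sum>k<length (s i). if j \<in> s i ! k then f j k else 0)
     = (\<Sum>k<length (s i). \<Sum>j\<in>s i ! k. f j k)" for f :: "nat \<Rightarrow> nat \<Rightarrow> real"
proof -
  have "(\<Sum>j\<in>firms G. if j \<in> s i ! k then f j k else 0) = (\<Sum>j\<in>s i ! k. f j k)"
    if "k < length (s i)" for k
  proof -
    have "firms G \<inter> {j. j \<in> s i ! k} = s i ! k"
      using class_subset[OF that] by (auto simp: creditors_def)
    then show ?thesis by (simp add: sum.If_cases)
  qed
  then show ?thesis by (subst sum.swap) simp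
qed

lemma sum_class_liability:
  "(\<Sum>k<length (s i). class_liability G s i k) = total_liability G i"
proof -
  have "liability G i j = (\<Sum>k<length (s i). if j \<in> s i ! k then liability G i j else 0)"
    if "j \<in> firms G" for j
  proof (cases "j \<in> creditors G i")
    case True
    then obtain k where k: "k < length (s i)" "j \<in> s i ! k" using ex_class by blast
    have "(\<Sum>m<length (s i). if j \<in> s i ! m then liability G i j else 0)
        = (\<Sum>m<length (s i). if m = k then liability G i j else 0)"
      using class_unique k by (intro sum.cong) auto
    then show ?thesis using k by simp
  next
    case False
    then have "liability G i j = 0"
      using liability_nonneg[OF firm that] that by (auto simp: creditors_def)
    then show ?thesis by (simp cong: if_cong)
  qed
  then have "total_liability G i
      = (\<Sum>j\<in>firms G. \<Sum>k<length (s i). if j \<in> s i ! k then liability G i j else 0)"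
    unfolding total_liability_def by (rule sum.cong[OF refl])
  then show ?thesis by (simp add: sum_over_classes class_liability_def)
qed

text \<open>Within each class the shares add up to a capped remainder, and successive caps telescope
  to \<open>min x (total_liability G i)\<close>.\<close>

lemma sum_share:
  assumes "0 \<le> x" "x \<le> total_liability G i"
  shows "(\<Sum>j\<in>firms G. share G s i j x) = x"
proof -
  have "(\<Sum>j\<in>firms G. share G s i j x) = (\<Sum>k<length (s i).
      min (max (x - (\<Sum>m<k. class_liability G s i m)) 0) (class_liability G s i k))"
    unfolding share_def sum_over_classes using sum_class_share by simp
  also have "\<dots> = min x (total_liability G i)"
    using class_liability_pos assms(1)
    by (subst sum_successive_caps) (auto simp: sum_class_liability less_imp_le)
  finally show ?thesis using assms by simp
qed

text \<open>The shares sum to the sum of their individual upper bounds, so every bound is attained.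
  Hence a solvent firm's payments do not depend on its strategy.\<close>

lemma share_total_liability:
  assumes "j \<in> firms G"
  shows "share G s i j (total_liability G i) = liability G i j"
proof -
  have "(\<Sum>j\<in>firms G. share G s i j (total_liability G i)) = (\<Sum>j\<in>firms G. liability G i j)"
    using sum_share total_liability_nonneg[OF firm] by (simp add: total_liability_def)
  then show ?thesis
    using sum_mono_inv[OF _ share_bounds(2) assms] by simp
qed

end

section \<open>Existence of maximal proper clearing payments\<close>

text \<open>Clearing matrices are determined by their outgoing totals. In the converse direction the
  entry bounds and the zero entries are recovered from \<open>share_bounds\<close> and
  \<open>liability_self\<close>.\<close>

lemma clearing_payments_iff_share:
  assumes s: "s \<in> profiles G"
  shows "clearing_payments G s P \<longleftrightarrow>
     (\<forall>i j. i \<notin> firms G \<or> j \<notin> firms G \<longrightarrow> P i j = 0) \<and>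
     (\<forall>i\<in>firms G. outgoing G P i = total_payment G i (incoming G P i)) \<and>
     (\<forall>i\<in>firms G. \<forall>j\<in>firms G. P i j = share G s i j (outgoing G P i))"
    (is "_ \<longleftrightarrow> ?R")
proof
  assume P: "clearing_payments G s P"
  have "P i j = share G s i j (outgoing G P i)" if ij: "i \<in> firms G" "j \<in> firms G" for i j
  proof (cases "j \<in> creditors G i")
    case True
    then obtain k where k: "k < length (s i)" "j \<in> s i ! k"
      using ex_class[OF s ij(1)] by blast
    then show ?thesis
      using P ij share_in_class[OF s ij(1) k]
      by (simp add: clearing_payments_def)
  next
    case False
    then have "liability G i j = 0"
      using liability_nonneg[OF ij] ij by (auto simp: creditors_def)
    then show ?thesis
      using P ij False share_not_creditor[OF s ij(1)]
      by (simp add: clearing_payments_def)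
  qed
  then show ?R
    using P by (simp add: clearing_payments_def total_payment_def)
next
  assume R: ?R
  have bounds: "0 \<le> P i j" "P i j \<le> liability G i j" if "i \<in> firms G" "j \<in> firms G" for i j
    using R that share_bounds[OF s that] by auto
  have class_eq: "P i j = min (max ((outgoing G P i - (\<Sum>m<k. class_liability G s i m))
        * (liability G i j / class_liability G s i k)) 0) (liability G i j)"
    if "i \<in> firms G" "k < length (s i)" "j \<in> s i ! k" for i j k
  proof -
    have "j \<in> firms G"
      using class_subset[OF s that(1,2)] that(3)
      by (auto simp: creditors_def)
    then show ?thesis
      using R that share_in_class[OF s that] by simp
  qed
  have "P i j = 0" if "i \<in> firms G" "j \<in> firms G" "liability G i j = 0" for i j
    using bounds[OF that(1,2)] that(3) by simp
  then show "clearing_payments G s P"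
    using R bounds class_eq liability_self
    unfolding clearing_payments_def total_payment_def by simp
qed

lemma clearing_payments_nonneg:
  "clearing_payments G s P \<Longrightarrow> i \<in> firms G \<Longrightarrow> j \<in> firms G \<Longrightarrow> 0 \<le> P i j"
  by (simp add: clearing_payments_def)

lemma incoming_nonneg:
  "clearing_payments G s P \<Longrightarrow> i \<in> firms G \<Longrightarrow> 0 \<le> incoming G P i"
  unfolding incoming_def by (intro sum_nonneg clearing_payments_nonneg)

lemma ex_greatest_clearing_payments:
  assumes s: "s \<in> profiles G"
  obtains P where "clearing_payments G s P"
    "\<And>Q i j. clearing_payments G s Q \<Longrightarrow> i \<in> firms G \<Longrightarrow> j \<in> firms G \<Longrightarrow> Q i j \<le> P i j"
proof -
  \<comment> \<open>The iteration runs on vectors \<open>p\<close> of outgoing totals: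
    \<open>inflow\<close> distributes them by \<open>share\<close>, and \<open>F\<close> computes
    the totals that result. Setting \<open>F p\<close> and \<open>hi\<close> to 0 outside the firms
    keeps the pointwise order meaningful on all indices.\<close>
  define inflow where "inflow p i = (\<Sum>j\<in>firms G. share G s j i (p j))" for p :: "nat \<Rightarrow> real" and i
  define F where "F p = (\<lambda>i. if i \<in> firms G then total_payment G i (inflow p i) else 0)" for p
  define hi where "hi i = (if i \<in> firms G then total_liability G i else 0)" for i
  have inflow_nonneg: "0 \<le> inflow p i" if "i \<in> firms G" for p i
    unfolding inflow_def using that by (intro sum_nonneg share_bounds s)
  have inflow_mono: "inflow p i \<le> inflow q i" if "i \<in> firms G" "p \<le> q" for p q i
    unfolding inflow_def using that by (intro sum_mono share_mono s) (auto simp: le_fun_def)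
  have F_box: "(\<lambda>_. 0) \<le> F p \<and> F p \<le> hi" for p
    by (auto simp: le_fun_def hi_def F_def total_payment_bounds inflow_nonneg)
  obtain p where p: "(\<lambda>_. 0) \<le> p" "p \<le> hi" "F p = p"
    "\<And>q. (\<lambda>_. 0) \<le> q \<Longrightarrow> q \<le> hi \<Longrightarrow> F q = q \<Longrightarrow> q \<le> p"
  proof (rule greatest_fixed_point_in_box[of "\<lambda>_. 0" hi F])
    show "(\<lambda>_. 0) \<le> hi"
      by (auto simp: le_fun_def hi_def total_liability_nonneg)
    show "(\<lambda>_. 0) \<le> F p \<and> F p \<le> hi" for p by (rule F_box)
    show "F p \<le> F q" if "p \<le> q" for p q
      using total_payment_mono[OF _ inflow_nonneg inflow_mono[OF _ that]]
      by (auto simp: le_fun_def F_def)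
  qed blast
  define P where "P i j = (if i \<in> firms G \<and> j \<in> firms G then share G s i j (p i) else 0)" for i j
  have out: "outgoing G P i = p i" if "i \<in> firms G" for i
  proof -
    have "outgoing G P i = (\<Sum>j\<in>firms G. share G s i j (p i))"
      using that by (simp add: outgoing_def P_def)
    moreover have "0 \<le> p i" "p i \<le> total_liability G i"
      using le_funD[OF p(1), of i] le_funD[OF p(2), of i] that by (auto simp: hi_def)
    ultimately show ?thesis
      using sum_share[OF s that] by simp
  qed
  have inc: "incoming G P i = inflow p i" if "i \<in> firms G" for i
    using that by (simp add: incoming_def inflow_def P_def)
  have "total_payment G i (inflow p i) = p i" if "i \<in> firms G" for i
    using fun_cong[OF p(3), of i] that by (simp add: F_def)
  then have "clearing_payments G s P"
    unfolding clearing_payments_iff_share[OF s] by (simp add: out inc) (simp add: P_def)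
  moreover have "Q i j \<le> P i j"
    if Q: "clearing_payments G s Q" and ij: "i \<in> firms G" "j \<in> firms G" for Q i j
  proof -
    \<comment> \<open>The outgoing totals of any clearing payments form a fixed point of
      \<open>F\<close>, hence lie below \<open>p\<close>; \<open>share_mono\<close> carries this
      over to the matrix entries.\<close>
    define q where "q i = (if i \<in> firms G then outgoing G Q i else 0)" for i
    note Q' = Q[unfolded clearing_payments_iff_share[OF s]]
    have Q_share: "Q i j = share G s i j (q i)" if "i \<in> firms G" "j \<in> firms G" for i j
      using Q' that by (simp add: q_def)
    have inc_Q: "incoming G Q i = inflow q i" if "i \<in> firms G" for i
      using that by (simp add: incoming_def inflow_def Q_share)
    have "F q = q"
      using Q' inc_Q by (auto simp: F_def q_def fun_eq_iff)
    then have "q \<le> p"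
      using F_box[of q] p(4)[of q] by simp
    then show ?thesis
      using share_mono[OF s ij] ij by (simp add: Q_share P_def le_fun_def)
  qed
  ultimately show thesis by (rule that)
qed

section \<open>Erasing payments not reachable from positive external assets\<close>

text \<open>\<open>proper_payments G P\<close> asks that every firm with a positive outgoing payment
  lie in this set.\<close>

definition funded_firms :: "(nat \<Rightarrow> nat \<Rightarrow> real) \<Rightarrow> nat set" where
  "funded_firms P = {i \<in> firms G. \<exists>k\<in>firms G. 0 < assets G k \<and> (k, i) \<in> (payment_edges G P)\<^sup>*}"

text \<open>A positive payment would extend a path from positive assets by one edge.\<close>

lemma payment_to_unfunded:
  assumes "clearing_payments G s P" "i \<in> funded_firms P" "j \<in> firms G - funded_firms P"
  shows "P i j = 0"
proof (rule ccontr)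
  assume "P i j \<noteq> 0"
  then have "(i, j) \<in> payment_edges G P"
    using assms clearing_payments_nonneg[OF assms(1), of i j]
    by (auto simp: payment_edges_def funded_firms_def)
  then show False
    using assms by (auto simp: funded_firms_def dest: rtrancl_into_rtrancl)
qed

lemma unfunded_assets: "i \<in> firms G - funded_firms P \<Longrightarrow> assets G i \<le> 0"
  unfolding funded_firms_def by force

lemma payment_from_unfunded:
  assumes s: "s \<in> profiles G" and P: "clearing_payments G s P"
    and "i \<in> firms G - funded_firms P" "j \<in> funded_firms P"
  shows "P i j = 0"
proof -
  define N where "N = firms G - funded_firms P"
  define R where "R = funded_firms P"
  have R: "R \<subseteq> firms G" "finite R" and N: "finite N" "N \<subseteq> firms G" and disj: "R \<inter> N = {}" "firms G = N \<union> R"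
    by (auto simp: N_def R_def funded_firms_def)
  have split: "(\<Sum>j\<in>firms G. f j) = (\<Sum>j\<in>N. f j) + (\<Sum>j\<in>R. f j)" for f :: "nat \<Rightarrow> real"
    using R N disj by (subst disj(2), subst sum.union_disjoint) auto
  \<comment> \<open>An unfunded firm has no positive assets and receives nothing from funded firms,
    so what it pays is at most its inflow from \<open>N\<close>.\<close>
  have "outgoing G P a \<le> (\<Sum>b\<in>N. P b a)" if "a \<in> N" for a
  proof -
    have a: "a \<in> firms G" "assets G a \<le> 0"
      using that unfunded_assets by (auto simp: N_def)
    have "outgoing G P a = total_payment G a (incoming G P a)"
      using P a(1) by (simp add: clearing_payments_iff_share[OF s])
    also have "\<dots> \<le> incoming G P a"
      using total_payment_le_funds[OF incoming_nonneg[OF P a(1)], of a]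
        incoming_nonneg[OF P a(1)] a(2) by linarith
    also have "\<dots> = (\<Sum>b\<in>N. P b a)"
      using payment_to_unfunded[OF P] that by (simp add: incoming_def split N_def R_def)
    finally show ?thesis .
  qed
  then have "(\<Sum>a\<in>N. outgoing G P a) \<le> (\<Sum>a\<in>N. \<Sum>b\<in>N. P b a)"
    by (rule sum_mono)
  also have "\<dots> = (\<Sum>a\<in>N. \<Sum>b\<in>N. P a b)"
    by (rule sum.swap)
  \<comment> \<open>Payments inside \<open>N\<close> occur on both sides and cancel, leaving the
    total flow from \<open>N\<close> to \<open>R\<close>.\<close>
  finally have "(\<Sum>a\<in>N. \<Sum>b\<in>R. P a b) \<le> 0"
    by (simp add: outgoing_def split sum.distrib)
  moreover have nonneg: "0 \<le> P a b" if "a \<in> N" "b \<in> R" for a b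
    using that R N clearing_payments_nonneg[OF P] by blast
  ultimately have "(\<Sum>a\<in>N. \<Sum>b\<in>R. P a b) = 0"
    by (meson antisym sum_nonneg)
  then have "\<forall>a\<in>N. \<forall>b\<in>R. P a b = 0"
    using nonneg N R by (simp add: sum_nonneg_eq_0_iff sum_nonneg)
  then show ?thesis
    using assms by (simp add: N_def R_def)
qed

text \<open>Funded firms lose no inflow, because unfunded firms paid them nothing. Unfunded firms
  are left with no inflow and no positive assets, for which paying nothing is consistent.\<close>

lemma clearing_payments_restrict_funded:
  assumes s: "s \<in> profiles G" and P: "clearing_payments G s P"
  shows "clearing_payments G s (\<lambda>i j. if i \<in> funded_firms P then P i j else 0)"
    (is "clearing_payments G s ?P'")
proof -
  note P' = P[unfolded clearing_payments_iff_share[OF s]]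
  have R: "funded_firms P \<subseteq> firms G" by (auto simp: funded_firms_def)
  have inc_funded: "incoming G ?P' i = incoming G P i" if "i \<in> funded_firms P" for i
    unfolding incoming_def using payment_from_unfunded[OF s P] that by (intro sum.cong) auto
  have inc_unfunded: "incoming G ?P' i = 0" if "i \<in> firms G - funded_firms P" for i
    unfolding incoming_def using payment_to_unfunded[OF P] that by (intro sum.neutral) auto
  have out_funded: "outgoing G ?P' i = outgoing G P i" if "i \<in> funded_firms P" for i
    using that by (simp add: outgoing_def)
  have out_unfunded: "outgoing G ?P' i = 0" if "i \<notin> funded_firms P" for i
    using that by (simp add: outgoing_def)
  have "outgoing G ?P' i = total_payment G i (incoming G ?P' i)" if i: "i \<in> firms G" for i
  proof (cases "i \<in> funded_firms P")
    case True
    then show ?thesis using P' i by (simp only: inc_funded out_funded)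
  next
    case False
    \<comment> \<open>This covers the solvent case too: payments never exceed the available funds,
      so such a firm owes nothing.\<close>
    then have "total_payment G i 0 = 0"
      using total_payment_le_funds[of 0 i] total_payment_bounds(1)[OF i, of 0]
        unfunded_assets[of i P] i by simp
    then show ?thesis using False i by (simp only: inc_unfunded out_unfunded Diff_iff simp_thms)
  qed
  moreover have "?P' i j = share G s i j (outgoing G ?P' i)"
    if ij: "i \<in> firms G" "j \<in> firms G" for i j
  proof (cases "i \<in> funded_firms P")
    case True
    then show ?thesis using P' ij by (simp only: out_funded if_True)
  next
    case False
    have "(\<Sum>b\<in>firms G. share G s i b 0) = 0"
      using sum_share[OF s ij(1)] total_liability_nonneg[OF ij(1)]
      by simp
    then have "share G s i j 0 = 0"
      using share_bounds(1)[OF s ij(1)] ij(2)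
      by (simp add: sum_nonneg_eq_0_iff)
    then show ?thesis using out_unfunded[OF False] False by simp
  qed
  ultimately show ?thesis
    using P' unfolding clearing_payments_iff_share[OF s] by simp
qed

text \<open>All firms on a path from positive assets are themselves funded, so each edge of the path
  survives the restriction.\<close>

lemma proper_payments_restrict_funded:
  "proper_payments G (\<lambda>i j. if i \<in> funded_firms P then P i j else 0)"
    (is "proper_payments G ?P'")
  unfolding proper_payments_def
proof (intro ballI impI)
  fix i assume "i \<in> firms G" "0 < outgoing G ?P' i"
  then have "i \<in> funded_firms P"
    by (cases "i \<in> funded_firms P") (simp_all add: outgoing_def)
  then obtain k where k: "k \<in> firms G" "0 < assets G k" "(k, i) \<in> (payment_edges G P)\<^sup>*"
    by (auto simp: funded_firms_def)
  have "(k, i) \<in> (payment_edges G ?P')\<^sup>*"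
    using k(3)
  proof (induction rule: rtrancl_induct)
    case (step a b)
    then have "a \<in> funded_firms P"
      using k by (auto simp: funded_firms_def payment_edges_def)
    then have "(a, b) \<in> payment_edges G ?P'"
      using step by (simp add: payment_edges_def)
    with step.IH show ?case by (rule rtrancl_into_rtrancl)
  qed simp
  with k show "\<exists>k\<in>firms G. 0 < assets G k \<and> (k, i) \<in> (payment_edges G ?P')\<^sup>*"
    by blast
qed

text \<open>The greatest clearing payments, restricted to funded firms, still dominate every proper
  \<open>Q\<close>.\<close>

lemma ex_maximal_clearing_payments:
  assumes s: "s \<in> profiles G"
  shows "\<exists>P. maximal_clearing_payments G s P"
proof -
  obtain P where P: "clearing_payments G s P"
    and greatest:
      "\<And>Q i j. clearing_payments G s Q \<Longrightarrow> i \<in> firms G \<Longrightarrow> j \<in> firms G \<Longrightarrow> Q i j \<le> P i j"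
    using ex_greatest_clearing_payments[OF s] by blast
  have "Q i j \<le> (if i \<in> funded_firms P then P i j else 0)"
    if Q: "clearing_payments G s Q" "proper_payments G Q"
      and ij: "i \<in> firms G" "j \<in> firms G" for Q i j
  proof (cases "0 < Q i j")
    case True
    have "0 < outgoing G Q i"
      unfolding outgoing_def using ij True clearing_payments_nonneg[OF Q(1)]
      by (intro sum_pos2[of _ j]) auto
    then obtain k where k: "k \<in> firms G" "0 < assets G k" "(k, i) \<in> (payment_edges G Q)\<^sup>*"
      using Q(2) ij by (auto simp: proper_payments_def)
    \<comment> \<open>Since \<open>P\<close> dominates \<open>Q\<close>, the path that funds
      \<open>i\<close> under \<open>Q\<close> is also a path under \<open>P\<close>.\<close>
    have "payment_edges G Q \<subseteq> payment_edges G P"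
      using greatest[OF Q(1)] by (force simp: payment_edges_def)
    then have "(k, i) \<in> (payment_edges G P)\<^sup>*"
      using k(3) rtrancl_mono by blast
    then have "i \<in> funded_firms P"
      using k ij by (auto simp: funded_firms_def)
    then show ?thesis using greatest[OF Q(1) ij] by simp
  next
    case False
    then show ?thesis using clearing_payments_nonneg[OF P ij] by auto
  qed
  then show ?thesis
    using clearing_payments_restrict_funded[OF s P] proper_payments_restrict_funded
    unfolding maximal_clearing_payments_def by blast
qed

lemma maximal_clearing_payments_unique:
  assumes "maximal_clearing_payments G s P" "maximal_clearing_payments G s Q"
  shows "P = Q"
proof (intro ext)
  fix i j
  show "P i j = Q i j"
  proof (cases "i \<in> firms G \<and> j \<in> firms G")
    case True
    then show ?thesis
      using assms by (auto simp: maximal_clearing_payments_def intro: antisym)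
  next
    case False
    then show ?thesis
      using assms by (auto simp: maximal_clearing_payments_def clearing_payments_def)
  qed
qed

text \<open>Existence and uniqueness justify the definite description in
  \<open>payments\<close>.\<close>

lemma maximal_payments: "s \<in> profiles G \<Longrightarrow> maximal_clearing_payments G s (payments G s)"
  unfolding payments_def
  using ex_maximal_clearing_payments maximal_clearing_payments_unique by (metis theI)

section \<open>Equilibria and welfare\<close>

theorem every_profile_strong_equilibrium:
  assumes s: "s \<in> profiles G"
  shows "strong_equilibrium G s"
proof -
  have False
    if C: "C \<noteq> {}" "C \<subseteq> firms G" and s': "s' \<in> profiles G"
      and same: "\<forall>i\<in>firms G - C. s' i = s i"
      and gain: "\<forall>i\<in>C. utility G s i < utility G s' i" for C s'
  proof -
    define P where "P = payments G s'"
    have P: "clearing_payments G s' P" "proper_payments G P"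
      using maximal_payments[OF s'] by (simp_all add: P_def maximal_clearing_payments_def)
    note P' = P(1)[unfolded clearing_payments_iff_share[OF s']]
    have "P i j = share G s i j (outgoing G P i)" if ij: "i \<in> firms G" "j \<in> firms G" for i j
    proof (cases "i \<in> C")
      case True
      then have "utility G s i < utility G s' i" using gain by blast
      \<comment> \<open>Utility under \<open>s\<close> is nonnegative, so a strict gain forces
        positive equity under \<open>s'\<close>.\<close>
      then have "total_liability G i \<le> assets G i + incoming G P i"
        by (auto simp: utility_def equity_def P_def)
      then have "outgoing G P i = total_liability G i"
        using P' ij by (simp add: total_payment_def)
      then show ?thesis
        using P' ij share_total_liability[OF s ij]
          share_total_liability[OF s' ij] by simp
    next
      case False
      then have "s' i = s i" using same ij by blast
      then have "share G s' i j x = share G s i j x" for x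
        unfolding share_def class_liability_def by (simp only:)
      then show ?thesis using P' ij by metis
    qed
    then have "clearing_payments G s P"
      using P' by (simp add: clearing_payments_iff_share[OF s])
    then have le: "P i j \<le> payments G s i j" if "i \<in> firms G" "j \<in> firms G" for i j
      using maximal_payments[OF s] P(2) that unfolding maximal_clearing_payments_def by blast
    \<comment> \<open>One coalition member suffices: equity is monotone in the incoming payments,
      which are no larger under \<open>s'\<close>.\<close>
    obtain i where i: "i \<in> C" "i \<in> firms G" using C by blast
    then have "incoming G P i \<le> incoming G (payments G s) i"
      unfolding incoming_def by (intro sum_mono le)
    then have "utility G s' i \<le> utility G s i"
      unfolding utility_def equity_def P_def by linarith
    then show False using gain i by force
  qed
  then show ?thesis
    using s unfolding strong_equilibrium_def by blast
qed

end

section \<open>Finiteness of the game and the welfare ratio\<close>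

text \<open>Classes are nonempty and pairwise disjoint, so no class repeats and a strategy is a
  distinct list of subsets of a finite set.\<close>

lemma finite_strategies: "finite (strategies G i)"
proof (rule finite_subset)
  have fin: "finite (creditors G i)" by (simp add: creditors_def)
  show "strategies G i \<subseteq> {cs. set cs \<subseteq> Pow (creditors G i) \<and> distinct cs}"
  proof (rule subsetI, rule CollectI, rule conjI)
    fix cs assume cs: "cs \<in> strategies G i"
    then show "set cs \<subseteq> Pow (creditors G i)"
      by (auto simp: strategies_def)
    show "distinct cs"
      unfolding distinct_conv_nth
    proof (intro allI impI notI)
      fix k m assume "k < length cs" "m < length cs" "k \<noteq> m" "cs ! k = cs ! m"
      then have "cs ! k = {}" using cs unfolding strategies_def by force
      then show False
        using cs nth_mem[OF \<open>k < length cs\<close>] by (simp add: strategies_def)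
    qed
  qed
  show "finite {cs. set cs \<subseteq> Pow (creditors G i) \<and> distinct cs}"
    using fin by (intro finite_subset_distinct) simp
qed

lemma finite_profiles: "finite (profiles G)"
  unfolding profiles_def by (intro finite_PiE finite_strategies) simp

lemma profiles_nonempty: "profiles G \<noteq> {}"
proof -
  have "strategies G i \<noteq> {}" for i
  \<comment> \<open>A firm without creditors has the empty list as its strategy, since
    \<open>[{}]\<close> would contain an empty class; otherwise a single class works.\<close>
  proof (cases "creditors G i = {}")
    case True
    then have "[] \<in> strategies G i" by (simp add: strategies_def)
    then show ?thesis by blast
  next
    case False
    then have "[creditors G i] \<in> strategies G i" by (simp add: strategies_def)
    then show ?thesis by blast
  qed
  then show ?thesis by (simp add: profiles_def PiE_eq_empty_iff)
qed

lemma social_welfare_nonneg: "0 \<le> social_welfare G P"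
  unfolding social_welfare_def equity_def by (intro sum_nonneg) simp

lemma social_welfare_le_optimal:
  "s \<in> profiles G \<Longrightarrow> social_welfare G (payments G s) \<le> optimal_welfare G"
  unfolding optimal_welfare_def using finite_profiles by (intro Max_ge) auto

lemma optimal_welfare_attained:
  obtains s where "s \<in> profiles G" "social_welfare G (payments G s) = optimal_welfare G"
proof -
  have "optimal_welfare G \<in> (\<lambda>s. social_welfare G (payments G s)) ` profiles G"
    unfolding optimal_welfare_def using finite_profiles profiles_nonempty by (intro Max_in) auto
  then show thesis using that by force
qed

lemma welfare_ratio_ge_1: "0 \<le> sw \<Longrightarrow> sw \<le> opt \<Longrightarrow> 1 \<le> welfare_ratio opt sw"
  by (auto simp: welfare_ratio_def one_ereal_def)

lemma welfare_ratio_refl: "welfare_ratio w w = 1"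
  by (simp add: welfare_ratio_def one_ereal_def)

text \<open>The optimal equilibrium has ratio 1, including the case 0/0, and no profile has a
  smaller ratio.\<close>

lemma strong_price_of_stability_eq_1:
  assumes "strong_equilibrium G s" "social_welfare G (payments G s) = optimal_welfare G"
  shows "strong_price_of_stability G = 1"
  unfolding strong_price_of_stability_def
proof (rule antisym)
  show "(INF s\<in>{s. strong_equilibrium G s}.
      welfare_ratio (optimal_welfare G) (social_welfare G (payments G s))) \<le> 1"
    using assms by (intro INF_lower2[of s]) (auto simp: welfare_ratio_refl)
  show "1 \<le> (INF s\<in>{s. strong_equilibrium G s}.
      welfare_ratio (optimal_welfare G) (social_welfare G (payments G s)))"
    by (intro INF_greatest welfare_ratio_ge_1 social_welfare_nonneg social_welfare_le_optimal)
      (simp add: strong_equilibrium_def)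
qed

theorem corollary17:
  shows "class_strong_price_of_stability {G. valid_network G} = 1 \<and>
         (\<forall>G. valid_network G \<longrightarrow>
            (\<exists>s. strong_equilibrium G s \<and>
                 social_welfare G (payments G s) = optimal_welfare G))"
proof -
  have optimal: "\<exists>s. strong_equilibrium G s \<and>
      social_welfare G (payments G s) = optimal_welfare G" if "valid_network G" for G
    using optimal_welfare_attained every_profile_strong_equilibrium[OF that] by metis
  then have price: "strong_price_of_stability G = 1" if "valid_network G" for G
    using that strong_price_of_stability_eq_1 by blast
  \<comment> \<open>The class must be nonempty: a supremum over no instances would be
    \<open>-\<infinity>\<close> rather than 1. The network without firms is a witness.\<close>
  have "valid_network \<lparr>firm_count = 0, assets = \<lambda>_. 0, liability = \<lambda>_ _. 0, alpha = 0, beta = 0\<rparr>"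
    by (simp add: valid_network_def firms_def)
  then have "{G. valid_network G} \<noteq> {}" by blast
  then have "class_strong_price_of_stability {G. valid_network G} = 1"
    unfolding class_strong_price_of_stability_def using price by simp
  then show ?thesis using optimal by blast
qed

end
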